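(* Let $R$ be a quasiorder on the set $U$ and let $S$ be the set of $R$-closed elements. The following statements are equivalent: (a) $S$ is cofinal in $U$; (b) $S$ is a dense element of the Heyting algebra $\mathcal{T}_R(U)$; (c) $S$ is the least dense element of the Heyting algebra $\mathcal{T}_R(U)$; (d) $\cong_S$ is the least Boolean congruence $\Gamma$ on the Heyting algebra $\mathcal{T}_R(U)$; (e) $\mathbb{IRS}_R(U)$ and $\mathbb{DRS}_R(U)$ are effective lattices.
   Context: A quasiorder on $U$ is a reflexive and transitive binary relation $R$ on $U$. Put $R(x)=\{y\in U\mid x\,R\,y\}$, $R(X)=\bigcup_{x\in X}R(x)$, and for $X\subseteq U$ let $X_R=\{x\in U\mid R(x)\subseteq X\}$, $X^R=\{x\in U\mid R(x)\cap X\neq\emptyset\}$, and $-X=U\setminus X$. A set $X$ is $R$-closed if $R(X)=X$; an element $x\in U$ is $R$-closed if $R(x)=\{x\}$. A set $X\subseteq U$ is cofinal in $U$ if for every $x\in U$ there is $y\in X$ with $x\,R\,y$. $\mathcal{T}_R(U)=\{X_R\mid X\subseteq U\}$ is the family of all $R$-closed sets; under inclusion it is a Heyting algebra $(\mathcal{T}_R(U),\cup,\cap,\Rightarrow,\emptyset,U)$ with $X\Rightarrow Y=(-X\cup Y)_R$ and pseudocomplement $X^*=X\Rightarrow\emptyset=-X^R$. An element $a$ of a Heyting algebra is dense if $a^*=0$. A congruence on a Heyting algebra (compatible with $\vee,\wedge,\Rightarrow$) is Boolean if its quotient is a Boolean algebra. The least Boolean congruence of a Heyting algebra is its Glivenko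 congruence $\Gamma=\{(a,b)\mid a^*=b^*\}$. The relation $\cong_S$ on $\mathcal{T}_R(U)$ is given by $X\cong_S Y$ iff $X\cap S=Y\cap S$. $\mathbb{DRS}_R(U)$ is the Nelson algebra on $\mathit{DRS}_R(U)=\{(X_R,-X^R)\mid X\subseteq U\}$, which equals $\{(A,B)\in\mathcal{T}_R(U)^2\mid A\cap B=\emptyset,\ A\cup B\cong_S U\}$, with operations $(A,B)\vee(C,D)=(A\cup C,B\cap D)$, $(A,B)\wedge(C,D)=(A\cap C,B\cup D)$, $(A,B)\to(C,D)=(A\Rightarrow C,A\cap D)$, ${\sim}(A,B)=(B,A)$. $\mathbb{IRS}_R(U)$ is the Nelson algebra on $\mathit{IRS}_R(U)=\{(X_R,X^R)\mid X\subseteq U\}$ obtained by transporting this structure along the bijection $(X_R,X^R)\mapsto(X_R,-X^R)$. By definition, $\mathbb{DRS}_R(U)$ and $\mathbb{IRS}_R(U)$ are called effective lattices if $\cong_S$ is the Glivenko congruence (least Boolean congruence) of $\mathcal{T}_R(U)$. *)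

theory Defs
  imports Main
begin

subsection \<open>Heyting and Boolean algebras with explicit carrier\<close>

record 'a imp_lattice =
  carrier :: "'a set"
  join :: "'a \<Rightarrow> 'a \<Rightarrow> 'a"
  meet :: "'a \<Rightarrow> 'a \<Rightarrow> 'a"
  imp :: "'a \<Rightarrow> 'a \<Rightarrow> 'a"
  zero :: "'a"
  one :: "'a"

definition le :: "('a, 'm) imp_lattice_scheme \<Rightarrow> 'a \<Rightarrow> 'a \<Rightarrow> bool" where
  "le L a b \<longleftrightarrow> meet L a b = a"

locale bounded_lattice_alg =
  fixes L :: "('a, 'm) imp_lattice_scheme"
  assumes zero_closed: "zero L \<in> carrier L"
    and one_closed: "one L \<in> carrier L"
    and join_closed: "\<lbrakk>a \<in> carrier L; b \<in> carrier L\<rbrakk> \<Longrightarrow> join L a b \<in> carrier L"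
    and meet_closed: "\<lbrakk>a \<in> carrier L; b \<in> carrier L\<rbrakk> \<Longrightarrow> meet L a b \<in> carrier L"
    and join_comm: "\<lbrakk>a \<in> carrier L; b \<in> carrier L\<rbrakk> \<Longrightarrow> join L a b = join L b a"
    and meet_comm: "\<lbrakk>a \<in> carrier L; b \<in> carrier L\<rbrakk> \<Longrightarrow> meet L a b = meet L b a"
    and join_assoc: "\<lbrakk>a \<in> carrier L; b \<in> carrier L; c \<in> carrier L\<rbrakk>
      \<Longrightarrow> join L (join L a b) c = join L a (join L b c)"
    and meet_assoc: "\<lbrakk>a \<in> carrier L; b \<in> carrier L; c \<in> carrier L\<rbrakk>
      \<Longrightarrow> meet L (meet L a b) c = meet L a (meet L b c)"
    and join_absorb: "\<lbrakk>a \<in> carrier L; b \<in> carrier L\<rbrakk> \<Longrightarrow> join L a (meet L a b) = a"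
    and meet_absorb: "\<lbrakk>a \<in> carrier L; b \<in> carrier L\<rbrakk> \<Longrightarrow> meet L a (join L a b) = a"
    and join_zero: "a \<in> carrier L \<Longrightarrow> join L a (zero L) = a"
    and meet_one: "a \<in> carrier L \<Longrightarrow> meet L a (one L) = a"

locale heyting_alg = bounded_lattice_alg +
  assumes imp_closed: "\<lbrakk>a \<in> carrier L; b \<in> carrier L\<rbrakk> \<Longrightarrow> imp L a b \<in> carrier L"
    and residuation: "\<lbrakk>a \<in> carrier L; b \<in> carrier L; c \<in> carrier L\<rbrakk>
      \<Longrightarrow> le L (meet L c a) b \<longleftrightarrow> le L c (imp L a b)"

text \<open>A Boolean algebra is a complemented distributive lattice; the implication is ignored.\<close>

locale boolean_alg = bounded_lattice_alg +
  assumes meet_join_distrib: "\<lbrakk>a \<in> carrier L; b \<in> carrier L; c \<in> carrier L\<rbrakk>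
      \<Longrightarrow> meet L a (join L b c) = join L (meet L a b) (meet L a c)"
    and complemented: "a \<in> carrier L
      \<Longrightarrow> \<exists>b \<in> carrier L. join L a b = one L \<and> meet L a b = zero L"

definition pcompl :: "('a, 'm) imp_lattice_scheme \<Rightarrow> 'a \<Rightarrow> 'a" where
  "pcompl H a = imp H a (zero H)"

definition dense_element :: "('a, 'm) imp_lattice_scheme \<Rightarrow> 'a \<Rightarrow> bool" where
  "dense_element H a \<longleftrightarrow> a \<in> carrier H \<and> pcompl H a = zero H"

definition least_dense_element :: "('a, 'm) imp_lattice_scheme \<Rightarrow> 'a \<Rightarrow> bool" where
  "least_dense_element H a \<longleftrightarrow>
     dense_element H a \<and> (\<forall>b. dense_element H b \<longrightarrow> le H a b)"

subsection \<open>Congruences\<close>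

definition heyting_congruence :: "('a, 'm) imp_lattice_scheme \<Rightarrow> 'a rel \<Rightarrow> bool" where
  "heyting_congruence H \<Theta> \<longleftrightarrow> equiv (carrier H) \<Theta> \<and>
     (\<forall>a b c d. (a, b) \<in> \<Theta> \<longrightarrow> (c, d) \<in> \<Theta> \<longrightarrow>
        (join H a c, join H b d) \<in> \<Theta> \<and>
        (meet H a c, meet H b d) \<in> \<Theta> \<and>
        (imp H a c, imp H b d) \<in> \<Theta>)"

text \<open>The operations on classes are written as unions over all representatives; for a congruence
  these unions consist of a single class.\<close>

definition quotient_alg :: "('a, 'm) imp_lattice_scheme \<Rightarrow> 'a rel \<Rightarrow> 'a set imp_lattice" where
  "quotient_alg H \<Theta> =
     \<lparr> carrier = carrier H // \<Theta>,
       join = (\<lambda>X Y. \<Union>x\<in>X. \<Union>y\<in>Y. \<Theta> `` {join H x y}),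
       meet = (\<lambda>X Y. \<Union>x\<in>X. \<Union>y\<in>Y. \<Theta> `` {meet H x y}),
       imp = (\<lambda>X Y. \<Union>x\<in>X. \<Union>y\<in>Y. \<Theta> `` {imp H x y}),
       zero = \<Theta> `` {zero H},
       one = \<Theta> `` {one H} \<rparr>"

definition boolean_congruence :: "('a, 'm) imp_lattice_scheme \<Rightarrow> 'a rel \<Rightarrow> bool" where
  "boolean_congruence H \<Theta> \<longleftrightarrow> heyting_congruence H \<Theta> \<and> boolean_alg (quotient_alg H \<Theta>)"

definition least_boolean_congruence :: "('a, 'm) imp_lattice_scheme \<Rightarrow> 'a rel \<Rightarrow> bool" where
  "least_boolean_congruence H \<Theta> \<longleftrightarrow>
     boolean_congruence H \<Theta> \<and> (\<forall>\<Phi>. boolean_congruence H \<Phi> \<longrightarrow> \<Theta> \<subseteq> \<Phi>)"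

definition glivenko :: "('a, 'm) imp_lattice_scheme \<Rightarrow> 'a rel" where
  "glivenko H = {(a, b). a \<in> carrier H \<and> b \<in> carrier H \<and> pcompl H a = pcompl H b}"

subsection \<open>Closed sets of a quasiorder\<close>

definition lower :: "'a set \<Rightarrow> 'a rel \<Rightarrow> 'a set \<Rightarrow> 'a set" where
  "lower U R X = {x \<in> U. R `` {x} \<subseteq> X}"

definition upper :: "'a set \<Rightarrow> 'a rel \<Rightarrow> 'a set \<Rightarrow> 'a set" where
  "upper U R X = {x \<in> U. R `` {x} \<inter> X \<noteq> {}}"

definition closed_sets :: "'a set \<Rightarrow> 'a rel \<Rightarrow> 'a set set" where
  "closed_sets U R = {lower U R X | X. X \<subseteq> U}"

definition closed_elements :: "'a set \<Rightarrow> 'a rel \<Rightarrow> 'a set" where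
  "closed_elements U R = {x \<in> U. R `` {x} = {x}}"

definition cofinal_in :: "'a set \<Rightarrow> 'a rel \<Rightarrow> 'a set \<Rightarrow> bool" where
  "cofinal_in U R X \<longleftrightarrow> X \<subseteq> U \<and> (\<forall>x\<in>U. \<exists>y\<in>X. (x, y) \<in> R)"

definition closed_sets_alg :: "'a set \<Rightarrow> 'a rel \<Rightarrow> 'a set imp_lattice" where
  "closed_sets_alg U R =
     \<lparr> carrier = closed_sets U R,
       join = (\<union>),
       meet = (\<inter>),
       imp = (\<lambda>X Y. lower U R ((U - X) \<union> Y)),
       zero = {},
       one = U \<rparr>"

definition cong_on :: "'a set \<Rightarrow> 'a rel \<Rightarrow> 'a set \<Rightarrow> 'a set rel" where
  "cong_on U R S =
     {(X, Y). X \<in> closed_sets U R \<and> Y \<in> closed_sets U R \<and> X \<inter> S = Y \<inter> S}"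

lemma closed_sets_iff:
  assumes "preorder_on U R"
  shows "X \<in> closed_sets U R \<longleftrightarrow> X \<subseteq> U \<and> R `` X = X"
proof -
  have R: "R \<subseteq> U \<times> U" "\<And>x. x \<in> U \<Longrightarrow> (x, x) \<in> R" "trans R"
    using assms by (auto simp: preorder_on_def refl_on_def)
  have "R `` lower U R Y = lower U R Y" for Y
    using R(1,2) transD[OF R(3)] unfolding lower_def by blast
  moreover have "lower U R X = X" if "X \<subseteq> U" "R `` X = X"
    using that R(2) unfolding lower_def by blast
  ultimately show ?thesis
    unfolding closed_sets_def by (smt (verit) lower_def mem_Collect_eq subsetI)
qed

lemma closed_sets_heyting:
  assumes "preorder_on U R"
  shows "heyting_alg (closed_sets_alg U R)"
proof -
  have T: "X \<in> closed_sets U R \<longleftrightarrow> X \<subseteq> U \<and> R `` X = X" for X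
    by (rule closed_sets_iff[OF assms])
  have R: "R \<subseteq> U \<times> U" "\<And>x. x \<in> U \<Longrightarrow> (x, x) \<in> R"
    using assms by (auto simp: preorder_on_def refl_on_def)
  have low: "lower U R X \<in> closed_sets U R" if "X \<subseteq> U" for X
    using that by (auto simp: closed_sets_def)
  have sub: "X \<subseteq> U" if "X \<in> closed_sets U R" for X
    using that by (simp add: T)
  have un: "X \<union> Y \<in> closed_sets U R" if "X \<in> closed_sets U R" "Y \<in> closed_sets U R" for X Y
    using that by (auto simp: T Image_Un)
  have int: "X \<inter> Y \<in> closed_sets U R" if "X \<in> closed_sets U R" "Y \<in> closed_sets U R" for X Y
    using that R(2) unfolding T by blast
  have zo: "{} \<in> closed_sets U R" "U \<in> closed_sets U R"
    using R unfolding T by blast+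
  have res: "C \<inter> A \<inter> B = C \<inter> A \<longleftrightarrow> C \<inter> lower U R ((U - A) \<union> B) = C"
    if "C \<in> closed_sets U R" for A B C
    using that R unfolding T lower_def by blast
  show ?thesis
  proof
    fix A B assume "A \<in> carrier (closed_sets_alg U R)" "B \<in> carrier (closed_sets_alg U R)"
    then show "imp (closed_sets_alg U R) A B \<in> carrier (closed_sets_alg U R)"
      using sub by (auto simp: closed_sets_alg_def intro!: low)
  qed (auto simp only: closed_sets_alg_def le_def imp_lattice.simps un int zo res dest: sub)
qed

subsection \<open>Nelson algebras of rough sets\<close>

record 'a nelson = "'a imp_lattice" +
  sneg :: "'a \<Rightarrow> 'a"

definition DRS :: "'a set \<Rightarrow> 'a rel \<Rightarrow> ('a set \<times> 'a set) set" where
  "DRS U R = {(lower U R X, U - upper U R X) | X. X \<subseteq> U}"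

definition IRS :: "'a set \<Rightarrow> 'a rel \<Rightarrow> ('a set \<times> 'a set) set" where
  "IRS U R = {(lower U R X, upper U R X) | X. X \<subseteq> U}"

definition DRS_alg :: "'a set \<Rightarrow> 'a rel \<Rightarrow> ('a set \<times> 'a set) nelson" where
  "DRS_alg U R =
     \<lparr> carrier = DRS U R,
       join = (\<lambda>(A, B) (C, D). (A \<union> C, B \<inter> D)),
       meet = (\<lambda>(A, B) (C, D). (A \<inter> C, B \<union> D)),
       imp = (\<lambda>(A, B) (C, D). (imp (closed_sets_alg U R) A C, A \<inter> D)),
       zero = ({}, U),
       one = (U, {}),
       sneg = (\<lambda>(A, B). (B, A)) \<rparr>"

text \<open>The map \<open>(A, B) \<mapsto> (A, U - B)\<close> is an involution on pairs of subsets of \<open>U\<close>; it exchanges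
  \<open>IRS U R\<close> and \<open>DRS U R\<close>, so that it is used below in both directions.\<close>

definition flip :: "'a set \<Rightarrow> 'a set \<times> 'a set \<Rightarrow> 'a set \<times> 'a set" where
  "flip U = (\<lambda>(A, B). (A, U - B))"

lemma flip_flip: "B \<subseteq> U \<Longrightarrow> flip U (flip U (A, B)) = (A, B)"
  by (auto simp: flip_def)

lemma bij_betw_flip: "bij_betw (flip U) (IRS U R) (DRS U R)"
  by (rule bij_betw_byWitness[where f' = "flip U"])
     (auto simp: flip_def IRS_def DRS_def upper_def)

definition IRS_alg :: "'a set \<Rightarrow> 'a rel \<Rightarrow> ('a set \<times> 'a set) nelson" where
  "IRS_alg U R =
     \<lparr> carrier = IRS U R,
       join = (\<lambda>p q. flip U (join (DRS_alg U R) (flip U p) (flip U q))),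
       meet = (\<lambda>p q. flip U (meet (DRS_alg U R) (flip U p) (flip U q))),
       imp = (\<lambda>p q. flip U (imp (DRS_alg U R) (flip U p) (flip U q))),
       zero = flip U (zero (DRS_alg U R)),
       one = flip U (one (DRS_alg U R)),
       sneg = (\<lambda>p. flip U (sneg (DRS_alg U R) (flip U p))) \<rparr>"

text \<open>Effectiveness is a property of the two algebras \<open>IRS_alg U R\<close> and \<open>DRS_alg U R\<close> only. It
  is defined through the congruence of the Heyting algebra of closed sets from which they are
  built.\<close>

definition effective_lattice :: "'a set \<Rightarrow> 'a rel \<Rightarrow> ('a set \<times> 'a set) nelson \<Rightarrow> bool" where
  "effective_lattice U R N \<longleftrightarrow> N \<in> {IRS_alg U R, DRS_alg U R} \<and>
     cong_on U R (closed_elements U R) = glivenko (closed_sets_alg U R)"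

end

theory Submission imports Defs begin

text \<open>In every Heyting algebra the Glivenko congruence is the least Boolean congruence: each Boolean
  congruence identifies an element with its double pseudocomplement. Hence (d) and (e) both say that
  \<open>cong_on U R S\<close> is the Glivenko congruence, and this holds if and only if \<open>S\<close> is cofinal. If it
  holds, then \<open>S\<close>, being related to \<open>U\<close>, is dense. Conversely, if \<open>S\<close> is cofinal, then the
  pseudocomplement of a closed set consists of the points that do not see its trace on \<open>S\<close>.\<close>

subsection \<open>Order in Heyting algebras with explicit carrier\<close>

context bounded_lattice_alg
begin

lemmas closed = zero_closed one_closed join_closed meet_closed

lemma meet_idem: "a \<in> carrier L \<Longrightarrow> meet L a a = a"
  by (metis join_zero meet_absorb zero_closed)

lemma le_refl: "a \<in> carrier L \<Longrightarrow> le L a a"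
  by (simp add: le_def meet_idem)

lemma le_antisym:
  "\<lbrakk>a \<in> carrier L; b \<in> carrier L; le L a b; le L b a\<rbrakk> \<Longrightarrow> a = b"
  by (metis le_def meet_comm)

lemma le_trans:
  "\<lbrakk>a \<in> carrier L; b \<in> carrier L; c \<in> carrier L; le L a b; le L b c\<rbrakk> \<Longrightarrow> le L a c"
  by (metis le_def meet_assoc)

lemma meet_le1: "\<lbrakk>a \<in> carrier L; b \<in> carrier L\<rbrakk> \<Longrightarrow> le L (meet L a b) a"
  by (metis le_def meet_assoc meet_closed meet_comm meet_idem)

lemma meet_le2: "\<lbrakk>a \<in> carrier L; b \<in> carrier L\<rbrakk> \<Longrightarrow> le L (meet L a b) b"
  by (metis meet_comm meet_le1)

lemma le_meetI:
  "\<lbrakk>a \<in> carrier L; b \<in> carrier L; c \<in> carrier L; le L c a; le L c b\<rbrakk> \<Longrightarrow> le L c (meet L a b)"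
  by (metis le_def meet_assoc)

lemma meet_mono:
  assumes "a \<in> carrier L" "b \<in> carrier L" "c \<in> carrier L" "d \<in> carrier L"
    and "le L a b" "le L c d"
  shows "le L (meet L a c) (meet L b d)"
proof (rule le_meetI)
  show "le L (meet L a c) b"
    using assms by (intro le_trans[of "meet L a c" a b]) (simp_all add: meet_closed meet_le1)
  show "le L (meet L a c) d"
    using assms by (intro le_trans[of "meet L a c" c d]) (simp_all add: meet_closed meet_le2)
qed (use assms in \<open>simp_all add: meet_closed\<close>)

lemma le_join1: "\<lbrakk>a \<in> carrier L; b \<in> carrier L\<rbrakk> \<Longrightarrow> le L a (join L a b)"
  by (simp add: le_def meet_absorb)

lemma le_join2: "\<lbrakk>a \<in> carrier L; b \<in> carrier L\<rbrakk> \<Longrightarrow> le L b (join L a b)"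
  by (metis join_comm le_join1)

lemma le_iff_join:
  "\<lbrakk>a \<in> carrier L; b \<in> carrier L\<rbrakk> \<Longrightarrow> le L a b \<longleftrightarrow> join L a b = b"
  by (metis join_absorb join_comm le_def meet_absorb meet_comm)

lemma join_leI:
  "\<lbrakk>a \<in> carrier L; b \<in> carrier L; c \<in> carrier L; le L a c; le L b c\<rbrakk> \<Longrightarrow> le L (join L a b) c"
  by (simp add: le_iff_join join_assoc closed)

lemma zero_le: "a \<in> carrier L \<Longrightarrow> le L (zero L) a"
  by (metis join_comm join_zero le_iff_join zero_closed)

lemma le_zero_iff: "a \<in> carrier L \<Longrightarrow> le L a (zero L) \<longleftrightarrow> a = zero L"
  by (metis le_antisym zero_closed zero_le)

lemma le_one: "a \<in> carrier L \<Longrightarrow> le L a (one L)"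
  by (simp add: le_def meet_one)

text \<open>An element is determined by its lower set, so equations can be proved by comparing lower
  bounds through adjunctions.\<close>

lemma eqI_le:
  assumes "a \<in> carrier L" "b \<in> carrier L" "\<And>x. x \<in> carrier L \<Longrightarrow> le L x a \<longleftrightarrow> le L x b"
  shows "a = b"
  using assms le_antisym le_refl by blast

end

section \<open>Distributivity and pseudocomplements in Heyting algebras\<close>

context heyting_alg
begin

text \<open>Meeting with \<open>a\<close> has the right adjoint \<open>imp L a\<close> by
  residuation, hence preserves joins; the other inequality is monotonicity.\<close>

lemma meet_join_distrib:
  assumes "a \<in> carrier L" "b \<in> carrier L" "c \<in> carrier L"
  shows "meet L a (join L b c) = join L (meet L a b) (meet L a c)" (is "?l = ?r")
proof (rule le_antisym)
  have "le L b (imp L a ?r)" "le L c (imp L a ?r)"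
    using assms by (metis residuation closed meet_comm le_join1, metis residuation closed meet_comm le_join2)
  then have "le L (join L b c) (imp L a ?r)"
    using assms by (simp add: join_leI closed imp_closed)
  then show "le L ?l ?r"
    using assms by (metis residuation closed(3,4) meet_comm)
  have "le L (meet L a x) ?l" if "x \<in> carrier L" "le L x (join L b c)" for x
    using assms that by (simp add: meet_mono le_refl closed)
  then show "le L ?r ?l"
    using assms by (simp add: join_leI closed le_join1 le_join2)
qed (use assms in \<open>auto simp: closed\<close>)

lemma pcompl_closed: "a \<in> carrier L \<Longrightarrow> pcompl L a \<in> carrier L"
  by (simp add: pcompl_def imp_closed zero_closed)

text \<open>Residuation at \<open>zero L\<close>: it reduces the laws of pseudocomplements to
  questions of disjointness.\<close>

lemma le_pcompl_iff:
  "\<lbrakk>a \<in> carrier L; x \<in> carrier L\<rbrakk> \<Longrightarrow> le L x (pcompl L a) \<longleftrightarrow> meet L x a = zero L"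
  by (metis pcompl_def residuation zero_closed le_zero_iff meet_closed)

lemma meet_pcompl: "a \<in> carrier L \<Longrightarrow> meet L a (pcompl L a) = zero L"
  by (metis le_pcompl_iff le_refl meet_comm pcompl_closed)

lemma le_double_pcompl: "a \<in> carrier L \<Longrightarrow> le L a (pcompl L (pcompl L a))"
  by (simp add: le_pcompl_iff meet_pcompl pcompl_closed)

lemma pcompl_antimono:
  assumes "a \<in> carrier L" "b \<in> carrier L" "le L a b"
  shows "le L (pcompl L b) (pcompl L a)"
  using assms
  by (metis le_def le_pcompl_iff le_refl le_trans le_double_pcompl meet_comm pcompl_closed)

text \<open>One inequality is \<open>le_double_pcompl\<close> at \<open>pcompl L a\<close>; the
  other applies the order-reversing \<open>pcompl\<close> to \<open>le_double_pcompl\<close> at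
  \<open>a\<close>.\<close>

lemma triple_pcompl: "a \<in> carrier L \<Longrightarrow> pcompl L (pcompl L (pcompl L a)) = pcompl L a"
  by (meson le_antisym le_double_pcompl pcompl_antimono pcompl_closed)

lemma pcompl_zero: "pcompl L (zero L) = one L"
proof (rule le_antisym)
  have "meet L (one L) (zero L) = zero L"
    using meet_le2[of "one L" "zero L"] by (simp add: le_zero_iff closed)
  then show "le L (one L) (pcompl L (zero L))"
    by (simp add: le_pcompl_iff closed)
qed (simp_all add: le_one closed pcompl_closed)

lemma pcompl_one: "pcompl L (one L) = zero L"
  by (metis meet_one meet_pcompl meet_comm one_closed pcompl_closed)

lemma pcompl_join:
  assumes "a \<in> carrier L" "b \<in> carrier L"
  shows "pcompl L (join L a b) = meet L (pcompl L a) (pcompl L b)"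
proof (rule le_antisym)
  show "le L (pcompl L (join L a b)) (meet L (pcompl L a) (pcompl L b))"
    using assms by (simp add: closed pcompl_closed le_meetI pcompl_antimono le_join1 le_join2)
  let ?x = "meet L (pcompl L a) (pcompl L b)"
  have x: "?x \<in> carrier L" "le L ?x (pcompl L a)" "le L ?x (pcompl L b)"
    using assms by (simp_all add: closed pcompl_closed meet_le1 meet_le2)
  then have "meet L ?x a = zero L" "meet L ?x b = zero L"
    using assms by (simp_all add: le_pcompl_iff)
  then show "le L ?x (pcompl L (join L a b))"
    using assms x(1) by (simp add: le_pcompl_iff meet_join_distrib closed join_zero)
qed (use assms in \<open>auto simp: closed pcompl_closed\<close>)

text \<open>By residuation, \<open>x\<close> lies below the pseudocomplement of
  \<open>meet L d c\<close> exactly if \<open>meet L x c\<close> lies below that of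
  \<open>d\<close>, so only \<open>pcompl L d\<close> matters. This gives compatibility of the
  Glivenko congruence with meets.\<close>

lemma pcompl_meet_cong:
  assumes "a \<in> carrier L" "b \<in> carrier L" "c \<in> carrier L" "pcompl L a = pcompl L b"
  shows "pcompl L (meet L a c) = pcompl L (meet L b c)"
proof (rule eqI_le)
  fix x assume x: "x \<in> carrier L"
  have "le L x (pcompl L (meet L d c)) \<longleftrightarrow> le L (meet L x c) (pcompl L d)" if "d \<in> carrier L" for d
    using assms(3) x that by (simp add: le_pcompl_iff closed meet_assoc meet_comm[of c])
  then show "le L x (pcompl L (meet L a c)) \<longleftrightarrow> le L x (pcompl L (meet L b c))"
    using assms by simp
qed (use assms in \<open>auto simp: closed pcompl_closed\<close>)

lemma meet_imp_le:
  "\<lbrakk>a \<in> carrier L; b \<in> carrier L\<rbrakk> \<Longrightarrow> le L (meet L (imp L a b) a) b"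
  by (simp add: residuation imp_closed le_refl)

text \<open>The right-hand side depends on \<open>a\<close> and \<open>b\<close> only through their
  pseudocomplements, which makes the Glivenko congruence compatible with implication.\<close>

lemma pcompl_imp:
  assumes "a \<in> carrier L" "b \<in> carrier L"
  shows "pcompl L (imp L a b) = meet L (pcompl L (pcompl L a)) (pcompl L b)"
proof (rule le_antisym)
  \<comment> \<open>Both \<open>b\<close> and \<open>pcompl L a\<close> lie below the implication;
    taking pseudocomplements reverses this.\<close>
  have "le L b (imp L a b)"
    using assms by (metis residuation meet_le1)
  moreover have "le L (pcompl L a) (imp L a b)"
    using assms by (metis residuation le_pcompl_iff le_refl pcompl_closed zero_le)
  ultimately show "le L (pcompl L (imp L a b)) (meet L (pcompl L (pcompl L a)) (pcompl L b))"
    using assms by (simp add: pcompl_antimono pcompl_closed imp_closed le_meetI)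
  \<comment> \<open>By modus ponens \<open>meet L ?y a\<close> lies below both \<open>b\<close> and
    its pseudocomplement, so it is zero. The law of triple pseudocomplements then replaces
    \<open>a\<close> by its double pseudocomplement.\<close>
  let ?y = "meet L (imp L a b) (pcompl L b)"
  have y: "?y \<in> carrier L"
    using assms by (simp add: closed pcompl_closed imp_closed)
  have "meet L ?y a = meet L (meet L (imp L a b) a) (pcompl L b)"
    using assms by (simp add: meet_assoc pcompl_closed imp_closed meet_comm[of a])
  moreover have "le L \<dots> (meet L b (pcompl L b))"
    using assms
    by (simp add: meet_mono meet_imp_le le_refl closed imp_closed pcompl_closed)
  ultimately have "meet L ?y a = zero L"
    using assms y by (metis le_zero_iff meet_closed meet_pcompl)
  then have "le L ?y (pcompl L a)"
    using assms y by (simp add: le_pcompl_iff)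
  then have "le L ?y (pcompl L (pcompl L (pcompl L a)))"
    using assms by (simp add: triple_pcompl)
  then have "meet L ?y (pcompl L (pcompl L a)) = zero L"
    using assms y by (simp add: le_pcompl_iff pcompl_closed)
  then have "meet L (meet L (pcompl L (pcompl L a)) (pcompl L b)) (imp L a b) = zero L"
    using assms by (metis meet_assoc meet_comm meet_closed pcompl_closed imp_closed)
  then show "le L (meet L (pcompl L (pcompl L a)) (pcompl L b)) (pcompl L (imp L a b))"
    using assms by (simp add: le_pcompl_iff imp_closed pcompl_closed closed)
qed (use assms in \<open>auto simp: closed pcompl_closed imp_closed\<close>)

text \<open>Relative to \<open>b\<close>, being disjoint from \<open>meet L a b\<close> is the same
  as being disjoint from \<open>a\<close>. It is applied below to a \<open>b\<close> that
  complements \<open>a\<close> modulo a congruence.\<close>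

lemma meet_pcompl_meet:
  assumes "a \<in> carrier L" "b \<in> carrier L"
  shows "meet L b (pcompl L (meet L a b)) = meet L b (pcompl L a)"
proof (rule le_antisym)
  let ?x = "meet L b (pcompl L (meet L a b))"
  have x: "?x \<in> carrier L"
    using assms by (simp add: closed pcompl_closed)
  have "meet L ?x a = meet L (meet L a b) (pcompl L (meet L a b))"
    using assms by (metis meet_assoc meet_comm closed(4) pcompl_closed)
  then have "le L ?x (pcompl L a)"
    using assms x by (simp add: le_pcompl_iff meet_pcompl closed)
  then show "le L ?x (meet L b (pcompl L a))"
    using assms x by (simp add: le_meetI pcompl_closed closed meet_le1)
  show "le L (meet L b (pcompl L a)) ?x"
    using assms
    by (simp add: meet_mono le_refl meet_le1 pcompl_antimono closed pcompl_closed)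
qed (use assms in \<open>auto simp: closed pcompl_closed\<close>)

end

subsection \<open>Quotients\<close>

lemma heyting_congruenceD:
  assumes "heyting_congruence H \<Theta>"
  shows "equiv (carrier H) \<Theta>"
    and "\<lbrakk>(a, b) \<in> \<Theta>; (c, d) \<in> \<Theta>\<rbrakk> \<Longrightarrow> (join H a c, join H b d) \<in> \<Theta>"
    and "\<lbrakk>(a, b) \<in> \<Theta>; (c, d) \<in> \<Theta>\<rbrakk> \<Longrightarrow> (meet H a c, meet H b d) \<in> \<Theta>"
    and "\<lbrakk>(a, b) \<in> \<Theta>; (c, d) \<in> \<Theta>\<rbrakk> \<Longrightarrow> (imp H a c, imp H b d) \<in> \<Theta>"
  using assms unfolding heyting_congruence_def by blast+

lemma quotient_alg_simps:
  assumes "heyting_congruence H \<Theta>" "a \<in> carrier H" "b \<in> carrier H"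
  shows "join (quotient_alg H \<Theta>) (\<Theta> `` {a}) (\<Theta> `` {b}) = \<Theta> `` {join H a b}"
    and "meet (quotient_alg H \<Theta>) (\<Theta> `` {a}) (\<Theta> `` {b}) = \<Theta> `` {meet H a b}"
proof -
  note c = heyting_congruenceD[OF assms(1)]
  \<comment> \<open>Join and meet are treated together: for any compatible \<open>f\<close> the
    union runs over copies of one single class.\<close>
  have "(\<Union>x\<in>\<Theta> `` {a}. \<Union>y\<in>\<Theta> `` {b}. \<Theta> `` {f x y}) = \<Theta> `` {f a b}"
    if "\<And>a b c d. \<lbrakk>(a, b) \<in> \<Theta>; (c, d) \<in> \<Theta>\<rbrakk> \<Longrightarrow> (f a c, f b d) \<in> \<Theta>" for f
  proof (rule UN_equiv_class2[OF c(1) c(1) _ assms(2,3)])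
    show "congruent2 \<Theta> \<Theta> (\<lambda>x y. \<Theta> `` {f x y})"
      using that by (auto intro!: congruent2I' equiv_class_eq[OF c(1)])
  qed
  from this[of "join H", OF c(2)] this[of "meet H", OF c(3)]
  show "join (quotient_alg H \<Theta>) (\<Theta> `` {a}) (\<Theta> `` {b}) = \<Theta> `` {join H a b}"
    "meet (quotient_alg H \<Theta>) (\<Theta> `` {a}) (\<Theta> `` {b}) = \<Theta> `` {meet H a b}"
    by (simp_all add: quotient_alg_def)
qed

lemma carrier_quotient_alg: "carrier (quotient_alg H \<Theta>) = (\<lambda>a. \<Theta> `` {a}) ` carrier H"
  by (auto simp: quotient_alg_def quotient_def)

context heyting_alg
begin

text \<open>The lattice identities and distributivity pass to the quotient, so only the existence of
  complements remains, read off on representatives.\<close>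

lemma boolean_alg_quotient_iff:
  assumes "heyting_congruence L \<Theta>"
  shows "boolean_alg (quotient_alg L \<Theta>) \<longleftrightarrow>
    (\<forall>a\<in>carrier L. \<exists>b\<in>carrier L. (join L a b, one L) \<in> \<Theta> \<and> (meet L a b, zero L) \<in> \<Theta>)"
proof -
  let ?Q = "quotient_alg L \<Theta>"
  note qs = quotient_alg_simps[OF assms] carrier_quotient_alg
  have z: "zero ?Q = \<Theta> `` {zero L}" "one ?Q = \<Theta> `` {one L}"
    by (simp_all add: quotient_alg_def)
  note q = qs z
  have bl: "bounded_lattice_alg ?Q"
    by unfold_locales
      (auto simp: q closed join_assoc meet_assoc
        join_absorb meet_absorb join_zero meet_one,
       simp_all only: join_comm meet_comm)
  have eq: "\<Theta> `` {x} = \<Theta> `` {y} \<longleftrightarrow> (x, y) \<in> \<Theta>" if "x \<in> carrier L" "y \<in> carrier L" for x y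
    using eq_equiv_class_iff[OF heyting_congruenceD(1)[OF assms] that] .
  have "boolean_alg ?Q \<longleftrightarrow>
    (\<forall>X\<in>carrier ?Q. \<exists>Y\<in>carrier ?Q. join ?Q X Y = one ?Q \<and> meet ?Q X Y = zero ?Q)"
  proof -
    have "meet ?Q X (join ?Q Y Z) = join ?Q (meet ?Q X Y) (meet ?Q X Z)"
      if "X \<in> carrier ?Q" "Y \<in> carrier ?Q" "Z \<in> carrier ?Q" for X Y Z
      using that by (auto simp: q meet_join_distrib closed)
    then show ?thesis
      using bl unfolding boolean_alg_def boolean_alg_axioms_def by blast
  qed
  also have "\<dots> \<longleftrightarrow>
    (\<forall>a\<in>carrier L. \<exists>b\<in>carrier L. \<Theta> `` {join L a b} = \<Theta> `` {one L}
      \<and> \<Theta> `` {meet L a b} = \<Theta> `` {zero L})"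
    by (simp add: q)
  finally show ?thesis
    by (simp add: eq closed)
qed

subsection \<open>The Glivenko congruence\<close>

lemma heyting_congruence_glivenko: "heyting_congruence L (glivenko L)"
  unfolding heyting_congruence_def
proof (intro conjI allI impI)
  show "equiv (carrier L) (glivenko L)"
    by (auto simp: glivenko_def intro!: equivI refl_onI symI transI)
  fix a b c d assume "(a, b) \<in> glivenko L" "(c, d) \<in> glivenko L"
  then have car: "a \<in> carrier L" "b \<in> carrier L" "c \<in> carrier L" "d \<in> carrier L"
    and eq: "pcompl L a = pcompl L b" "pcompl L c = pcompl L d"
    by (auto simp: glivenko_def)
  have "pcompl L (meet L a c) = pcompl L (meet L b d)"
    using car eq by (metis pcompl_meet_cong meet_comm)
  with car eq show "(join L a c, join L b d) \<in> glivenko L"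
    and "(meet L a c, meet L b d) \<in> glivenko L" and "(imp L a c, imp L b d) \<in> glivenko L"
    by (simp_all add: glivenko_def closed imp_closed pcompl_join pcompl_imp)
qed

text \<open>The class of \<open>pcompl L a\<close> complements that of \<open>a\<close>: by
  \<open>pcompl_join\<close> the pseudocomplement of their join is zero, as is that of
  \<open>one L\<close>.\<close>

lemma boolean_congruence_glivenko: "boolean_congruence L (glivenko L)"
proof -
  have "(join L a (pcompl L a), one L) \<in> glivenko L \<and> (meet L a (pcompl L a), zero L) \<in> glivenko L"
    if "a \<in> carrier L" for a
    using that
    by (simp add: glivenko_def closed pcompl_closed pcompl_join pcompl_one meet_pcompl)
  then show ?thesis
    unfolding boolean_congruence_def boolean_alg_quotient_iff[OF heyting_congruence_glivenko]
    using heyting_congruence_glivenko pcompl_closed by blast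
qed

text \<open>Let \<open>b\<close> complement \<open>a\<close> modulo \<Phi>. Then \<open>b\<close> is
  congruent to its meet with \<open>pcompl L a\<close>, so the double pseudocomplement of
  \<open>a\<close> meets \<open>b\<close> in an element congruent to zero. Distributing it over
  \<open>join L a b\<close>, which is congruent to one, leaves \<open>a\<close> up to
  \<Phi>.\<close>

lemma boolean_congruence_double_pcompl:
  assumes "boolean_congruence L \<Phi>" "a \<in> carrier L"
  shows "(pcompl L (pcompl L a), a) \<in> \<Phi>"
proof -
  have hc: "heyting_congruence L \<Phi>"
    using assms(1) by (simp add: boolean_congruence_def)
  note c = heyting_congruenceD[OF hc]
  have r: "(x, x) \<in> \<Phi>" if "x \<in> carrier L" for x
    using that c(1) by (simp add: equiv_class_eq_iff)
  have tr: "(x, y) \<in> \<Phi> \<Longrightarrow> (y, z) \<in> \<Phi> \<Longrightarrow> (x, z) \<in> \<Phi>" for x y z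
    using c(1) by (meson equivE transD)
  have sy: "(x, y) \<in> \<Phi> \<Longrightarrow> (y, x) \<in> \<Phi>" for x y
    using c(1) by (meson equivE symD)
  obtain b where b: "b \<in> carrier L" "(join L a b, one L) \<in> \<Phi>" "(meet L a b, zero L) \<in> \<Phi>"
    using assms boolean_alg_quotient_iff[OF hc] by (auto simp: boolean_congruence_def)
  let ?n = "pcompl L a" and ?nn = "pcompl L (pcompl L a)"
  note car = assms(2) b(1) closed pcompl_closed
  have "(pcompl L (meet L a b), one L) \<in> \<Phi>"
    using c(4)[OF b(3) r[OF zero_closed]] pcompl_zero by (simp add: pcompl_def)
  then have "(meet L b ?n, b) \<in> \<Phi>"
    using c(3)[OF r[OF b(1)]] car by (metis meet_one meet_pcompl_meet)
  then have "(meet L ?nn (meet L b ?n), meet L ?nn b) \<in> \<Phi>"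
    using car by (intro c(3)[OF r]) simp_all
  moreover have "meet L ?nn (meet L b ?n) = zero L"
    using car by (metis le_zero_iff meet_assoc meet_comm meet_le2 meet_pcompl)
  ultimately have "(meet L ?nn b, zero L) \<in> \<Phi>"
    by (simp add: sy)
  then have "(join L a (meet L ?nn b), a) \<in> \<Phi>"
    using c(2)[OF r[OF assms(2)]] car by (metis join_zero)
  \<comment> \<open>Distributivity, where \<open>meet L ?nn a\<close> is \<open>a\<close> since
    \<open>a\<close> lies below \<open>?nn\<close>.\<close>
  moreover have "join L a (meet L ?nn b) = meet L ?nn (join L a b)"
    using car le_double_pcompl[OF assms(2)]
    by (metis le_def meet_comm meet_join_distrib)
  moreover have "(meet L ?nn (join L a b), ?nn) \<in> \<Phi>"
    using c(3)[OF r b(2)] car by (metis meet_one)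
  ultimately show ?thesis
    using sy tr by metis
qed

text \<open>If \<open>a\<close> and \<open>b\<close> have equal pseudocomplements, each is congruent
  to the same double pseudocomplement under any Boolean congruence.\<close>

lemma least_boolean_congruence_glivenko: "least_boolean_congruence L (glivenko L)"
  unfolding least_boolean_congruence_def
proof (intro conjI allI impI boolean_congruence_glivenko)
  fix \<Phi> assume \<Phi>: "boolean_congruence L \<Phi>"
  then have "equiv (carrier L) \<Phi>"
    by (simp add: boolean_congruence_def heyting_congruence_def)
  then have "sym \<Phi>" "trans \<Phi>"
    by (auto elim: equivE)
  then show "glivenko L \<subseteq> \<Phi>"
    using boolean_congruence_double_pcompl[OF \<Phi>]
    by (auto simp: glivenko_def) (metis symD transD)
qed

lemma least_boolean_congruence_iff: "least_boolean_congruence L \<Theta> \<longleftrightarrow> \<Theta> = glivenko L"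
  using least_boolean_congruence_glivenko
  by (auto simp: least_boolean_congruence_def)

end

subsection \<open>Closed elements of a quasiorder\<close>

text \<open>No relation between \<open>R\<close> and \<open>U\<close> is assumed here, so the
  condition that successors stay in \<open>U\<close> has to be recorded.\<close>

lemma pcompl_closed_sets_alg:
  "pcompl (closed_sets_alg U R) X = {x \<in> U. R `` {x} \<inter> X = {} \<and> R `` {x} \<subseteq> U}"
  by (auto simp: pcompl_def closed_sets_alg_def lower_def)

context
  fixes U :: "'a set" and R :: "'a rel"
  assumes preorder: "preorder_on U R"
begin

private lemma sub: "R \<subseteq> U \<times> U"
  using preorder by (simp add: preorder_on_def)

private lemma refl: "x \<in> U \<Longrightarrow> (x, x) \<in> R"
  using preorder by (simp add: preorder_on_def refl_on_def)

private lemma trans: "(x, y) \<in> R \<Longrightarrow> (y, z) \<in> R \<Longrightarrow> (x, z) \<in> R"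
  using preorder unfolding preorder_on_def by (meson transD)

lemma closed_elements_iff:
  "x \<in> closed_elements U R \<longleftrightarrow> x \<in> U \<and> (\<forall>y. (x, y) \<in> R \<longleftrightarrow> y = x)"
  unfolding closed_elements_def by blast

lemma closed_elements_in_closed_sets: "closed_elements U R \<in> closed_sets U R"
  unfolding closed_sets_iff[OF preorder] by (fastforce simp: closed_elements_iff)

text \<open>The pseudocomplement of \<open>X\<close> collects the points that see nothing in
  \<open>X\<close>; it is empty exactly when every point sees some element of
  \<open>X\<close>.\<close>

lemma dense_element_iff:
  "dense_element (closed_sets_alg U R) X \<longleftrightarrow> X \<in> closed_sets U R \<and> cofinal_in U R X"
proof -
  have "X \<subseteq> U" if "X \<in> closed_sets U R"
    using that by (simp add: closed_sets_iff[OF preorder])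
  moreover have "carrier (closed_sets_alg U R) = closed_sets U R" "zero (closed_sets_alg U R) = {}"
    by (simp_all add: closed_sets_alg_def)
  ultimately show ?thesis
    using sub by (fastforce simp: dense_element_def pcompl_closed_sets_alg cofinal_in_def)
qed

text \<open>A closed element sees only itself, so the element of \<open>X\<close> above it can be no
  other. This yields minimality among dense elements.\<close>

lemma cofinal_imp_closed_elements_subset:
  "cofinal_in U R X \<Longrightarrow> closed_elements U R \<subseteq> X"
  unfolding cofinal_in_def closed_elements_iff subset_iff by metis

text \<open>If \<open>x\<close> sees \<open>y\<close> in \<open>X\<close>, cofinality gives some
  \<open>z\<close> in \<open>S\<close> above \<open>y\<close>. It stays in \<open>X\<close> because
  \<open>X\<close> is closed, and \<open>x\<close> sees it by transitivity.\<close>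

lemma pcompl_cofinal:
  assumes "cofinal_in U R S" "X \<in> closed_sets U R"
  shows "pcompl (closed_sets_alg U R) X = {x \<in> U. R `` {x} \<inter> (X \<inter> S) = {}}"
proof -
  have X: "X \<subseteq> U" "R `` X = X"
    using assms(2) by (simp_all add: closed_sets_iff[OF preorder])
  have "\<exists>z. (x, z) \<in> R \<and> z \<in> X \<inter> S" if xy: "(x, y) \<in> R" "y \<in> X" for x y
  proof -
    obtain z where "z \<in> S" "(y, z) \<in> R"
      using assms(1) X(1) xy(2) unfolding cofinal_in_def by blast
    then show ?thesis
      using X(2) xy trans by blast
  qed
  then show ?thesis
    using sub unfolding pcompl_closed_sets_alg by blast
qed

lemma cong_on_eq_glivenko_iff:
  "cong_on U R (closed_elements U R) = glivenko (closed_sets_alg U R) \<longleftrightarrow>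
    cofinal_in U R (closed_elements U R)" (is "?C = ?\<Gamma> \<longleftrightarrow> cofinal_in U R ?S")
proof
  have U: "U \<in> closed_sets U R"
    using sub refl by (auto simp: closed_sets_iff[OF preorder])
  \<comment> \<open>Both sets have trace \<open>?S\<close> on \<open>?S\<close>. As \<open>U\<close>
    is dense by reflexivity, equality of pseudocomplements will transfer density to
    \<open>?S\<close>.\<close>
  have "(?S, U) \<in> ?C"
    using U closed_elements_in_closed_sets by (auto simp: cong_on_def closed_elements_def)
  moreover assume "?C = ?\<Gamma>"
  ultimately have "pcompl (closed_sets_alg U R) ?S = pcompl (closed_sets_alg U R) U"
    by (auto simp: glivenko_def)
  moreover have "dense_element (closed_sets_alg U R) U"
    using U refl unfolding dense_element_iff cofinal_in_def by auto
  ultimately have "dense_element (closed_sets_alg U R) ?S"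
    using closed_elements_in_closed_sets
    by (auto simp: dense_element_def closed_sets_alg_def)
  then show "cofinal_in U R ?S"
    by (simp add: dense_element_iff)
next
  assume cof: "cofinal_in U R ?S"
  have car: "carrier (closed_sets_alg U R) = closed_sets U R"
    by (simp add: closed_sets_alg_def)
  \<comment> \<open>A closed element sees only itself, so it avoids the pseudocomplement exactly
    when it lies in \<open>X\<close>. Thus the pseudocomplement determines the trace;
    \<open>pcompl_cofinal\<close> gives the converse.\<close>
  have trace: "X \<inter> ?S = {x \<in> ?S. x \<notin> pcompl (closed_sets_alg U R) X}" for X
    using sub by (auto simp: pcompl_closed_sets_alg closed_elements_iff)
  have "X \<inter> ?S = Y \<inter> ?S \<longleftrightarrow>
    pcompl (closed_sets_alg U R) X = pcompl (closed_sets_alg U R) Y"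
    if "X \<in> closed_sets U R" "Y \<in> closed_sets U R" for X Y
  proof
    show "pcompl (closed_sets_alg U R) X = pcompl (closed_sets_alg U R) Y" if "X \<inter> ?S = Y \<inter> ?S"
      by (simp only: pcompl_cofinal[OF cof] \<open>X \<in> closed_sets U R\<close> \<open>Y \<in> closed_sets U R\<close> that)
    show "X \<inter> ?S = Y \<inter> ?S" if "pcompl (closed_sets_alg U R) X = pcompl (closed_sets_alg U R) Y"
      by (simp only: trace that)
  qed
  then show "?C = ?\<Gamma>"
    by (auto simp: cong_on_def glivenko_def car)
qed

end

theorem proposition4p6:
  fixes U :: "'a set" and R :: "'a rel" and S :: "'a set"
  assumes "preorder_on U R"
    and "S = closed_elements U R"
  shows "(cofinal_in U R S \<longleftrightarrow> dense_element (closed_sets_alg U R) S)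
    \<and> (cofinal_in U R S \<longleftrightarrow> least_dense_element (closed_sets_alg U R) S)
    \<and> (cofinal_in U R S \<longleftrightarrow> least_boolean_congruence (closed_sets_alg U R) (cong_on U R S))
    \<and> (cofinal_in U R S \<longleftrightarrow>
         effective_lattice U R (IRS_alg U R) \<and> effective_lattice U R (DRS_alg U R))"
proof -
  have ab: "cofinal_in U R S \<longleftrightarrow> dense_element (closed_sets_alg U R) S"
    using assms by (simp add: dense_element_iff closed_elements_in_closed_sets)
  \<comment> \<open>\<open>S\<close> lies below every dense element whether or not \<open>S\<close>
    is dense, so density of \<open>S\<close> already makes it the least one.\<close>
  moreover have "le (closed_sets_alg U R) S X" if "dense_element (closed_sets_alg U R) X" for X
    using cofinal_imp_closed_elements_subset[OF assms(1)] that assms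
    unfolding dense_element_iff[OF assms(1)] by (auto simp: le_def closed_sets_alg_def)
  ultimately have "cofinal_in U R S \<longleftrightarrow> least_dense_element (closed_sets_alg U R) S"
    by (auto simp: least_dense_element_def)
  moreover have "cong_on U R S = glivenko (closed_sets_alg U R) \<longleftrightarrow> cofinal_in U R S"
    using cong_on_eq_glivenko_iff assms by simp
  ultimately show ?thesis
    using ab heyting_alg.least_boolean_congruence_iff[OF closed_sets_heyting[OF assms(1)]] assms(2)
    by (simp add: effective_lattice_def)
qed

end
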